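(* Let $d\ge 3$ be an integer and let $G$ be a finite graph. Then $G$ admits an $H_d$-flow if and only if $G$ admits an oriented $d$-cycle double cover.
   Context: $H_d$ is the set of vectors in $\mathbb{R}^d$ with integer coordinates, exactly one coordinate equal to $1$, exactly one equal to $-1$ and all others $0$ (equivalently $H_d=\{x\in\mathbb{Z}^d:\sum_i x_i=0,\ \sum_i x_i^2=2\}$). For a set $X\subseteq\mathbb{R}^d$, an $X$-flow on $G$ is an orientation $O$ of $G$ together with a map $\varphi:E(G)\to X$ such that at every vertex $v$ the sum of $\varphi(e)$ over edges directed out of $v$ equals the sum of $\varphi(e)$ over edges directed into $v$. A cycle of $G$ is a subgraph in which every vertex has even degree; given an orientation $O_i$ of a cycle $C_i$, $O_i(C_i)$ is a directed cycle if at every vertex of $C_i$ the indegree equals the outdegree. An oriented $d$-cycle double cover of $G$ is a collection $\{O_1(C_1),\dots,O_d(C_d)\}$ of $d$ directed cycles of $G$ such that every edge of $G$ lies in exactly two of the cycles $C_i,C_j$ and the orientations $O_i$ and $O_j$ are opposite on that edge. *)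

theory Defs
  imports
    "HOL-Analysis.Analysis"
    "HOL-Library.Uprod"
    "Graph_Theory.Digraph"
begin

(* Undirected graphs; parallel edges and loops are permitted. *)

record ('v, 'e) multigraph =
  vertices :: "'v set"
  edges :: "'e set"
  ends :: "'e \<Rightarrow> 'v uprod"

definition multigraph :: "('v, 'e) multigraph \<Rightarrow> bool" where
  "multigraph G \<longleftrightarrow> (\<forall>e\<in>edges G. set_uprod (ends G e) \<subseteq> vertices G)"

definition finite_multigraph :: "('v, 'e) multigraph \<Rightarrow> bool" where
  "finite_multigraph G \<longleftrightarrow> multigraph G \<and> finite (vertices G) \<and> finite (edges G)"

definition subgraph_of :: "('v, 'e) multigraph \<Rightarrow> ('v, 'e) multigraph \<Rightarrow> bool" where
  "subgraph_of C G \<longleftrightarrow> multigraph C \<and> vertices C \<subseteq> vertices G \<and> edges C \<subseteq> edges G \<and>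
     (\<forall>e\<in>edges C. ends C e = ends G e)"

(* The second summand makes a loop count twice. *)
definition degree_at :: "('v, 'e) multigraph \<Rightarrow> 'v \<Rightarrow> nat" where
  "degree_at G v = card {e \<in> edges G. v \<in> set_uprod (ends G e)} +
     card {e \<in> edges G. ends G e = Upair v v}"

(* An orientation of G is a digraph with the same vertices and edge names. A loop has only one
   orientation in this encoding, and that orientation is opposite to itself. *)
definition orientation_of :: "('v, 'e) pre_digraph \<Rightarrow> ('v, 'e) multigraph \<Rightarrow> bool" where
  "orientation_of D G \<longleftrightarrow> verts D = vertices G \<and> arcs D = edges G \<and>
     (\<forall>e\<in>edges G. Upair (tail D e) (head D e) = ends G e)"

definition vector_flow ::
  "(real ^ 'n) set \<Rightarrow> ('v, 'e) multigraph \<Rightarrow> ('v, 'e) pre_digraph \<Rightarrow> ('e \<Rightarrow> real ^ 'n) \<Rightarrow> bool" where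
  "vector_flow X G D \<phi> \<longleftrightarrow> orientation_of D G \<and> (\<forall>e\<in>edges G. \<phi> e \<in> X) \<and>
     (\<forall>v\<in>vertices G. (\<Sum>e\<in>out_arcs D v. \<phi> e) = (\<Sum>e\<in>in_arcs D v. \<phi> e))"

definition admits_vector_flow :: "(real ^ 'n) set \<Rightarrow> ('v, 'e) multigraph \<Rightarrow> bool" where
  "admits_vector_flow X G \<longleftrightarrow> (\<exists>D \<phi>. vector_flow X G D \<phi>)"

definition H_vectors :: "(real ^ 'd) set" where
  "H_vectors = {x. (\<exists>!i. x $ i = 1) \<and> (\<exists>!j. x $ j = -1) \<and>
     (\<forall>k. x $ k \<noteq> 1 \<and> x $ k \<noteq> -1 \<longrightarrow> x $ k = 0)}"

(* Cycles in the sense of even subgraphs: neither connectedness nor nonemptiness is required. *)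
definition cycle_of :: "('v, 'e) multigraph \<Rightarrow> ('v, 'e) multigraph \<Rightarrow> bool" where
  "cycle_of C G \<longleftrightarrow> subgraph_of C G \<and> (\<forall>v\<in>vertices C. even (degree_at C v))"

definition directed_cycle_on ::
  "('v, 'e) pre_digraph \<Rightarrow> ('v, 'e) multigraph \<Rightarrow> bool" where
  "directed_cycle_on D C \<longleftrightarrow> orientation_of D C \<and>
     (\<forall>v\<in>vertices C. in_degree D v = out_degree D v)"

(* The d cycles form an indexed family, so that the empty cycle may occur repeatedly. *)
definition oriented_cycle_double_cover ::
  "nat \<Rightarrow> ('v, 'e) multigraph \<Rightarrow> (nat \<Rightarrow> ('v, 'e) multigraph) \<Rightarrow>
   (nat \<Rightarrow> ('v, 'e) pre_digraph) \<Rightarrow> bool" where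
  "oriented_cycle_double_cover d G C D \<longleftrightarrow>
     (\<forall>i<d. cycle_of (C i) G \<and> directed_cycle_on (D i) (C i)) \<and>
     (\<forall>e\<in>edges G. \<exists>i<d. \<exists>j<d. i \<noteq> j \<and> {k. k < d \<and> e \<in> edges (C k)} = {i, j} \<and>
        tail (D i) e = head (D j) e \<and> head (D i) e = tail (D j) e)"

definition admits_oriented_cycle_double_cover :: "nat \<Rightarrow> ('v, 'e) multigraph \<Rightarrow> bool" where
  "admits_oriented_cycle_double_cover d G \<longleftrightarrow> (\<exists>C D. oriented_cycle_double_cover d G C D)"

end

(* The k-th cycle of the cover is the support of the k-th coordinate of the flow, with the
   orientation of the flow reversed where that coordinate is -1. A vector of H_d has exactly one
   entry 1 and one entry -1, so every edge is covered twice and in opposite directions; and the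
   flow equation at a vertex, read in coordinate k, says that the k-th cycle is balanced there. *)
theory Submission
  imports Defs
begin

section \<open>Signed incidence and balance at a vertex\<close>

text \<open>The entry of the oriented incidence matrix in row \<open>v\<close> and column
  \<open>e\<close>. A loop gets 0, so it drops out of every balance condition.\<close>

definition net_incidence :: "('v, 'e) pre_digraph \<Rightarrow> 'v \<Rightarrow> 'e \<Rightarrow> real" where
  "net_incidence D v e = of_bool (tail D e = v) - of_bool (head D e = v)"

lemma net_incidence_eq_minus_if_opposite:
  assumes "tail D e = head D' e" "head D e = tail D' e"
  shows "net_incidence D' v e = - net_incidence D v e"
  using assms by (simp add: net_incidence_def)

text \<open>With the signs moved into the summand, the index set no longer depends on
  \<open>v\<close> or on the direction of the arcs, so sums for different orientations can be
  compared term by term. Values in \<open>real ^ 'd\<close> give the flow equation, the constant 1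
  gives the degrees.\<close>

lemma out_arcs_sum_eq_in_arcs_sum_iff:
  fixes f :: "'e \<Rightarrow> 'a::real_vector"
  assumes "finite (arcs D)"
  shows "(\<Sum>e\<in>out_arcs D v. f e) = (\<Sum>e\<in>in_arcs D v. f e) \<longleftrightarrow>
    (\<Sum>e\<in>arcs D. net_incidence D v e *\<^sub>R f e) = 0"
proof -
  have "(\<Sum>e\<in>out_arcs D v. f e) = (\<Sum>e\<in>arcs D. of_bool (tail D e = v) *\<^sub>R f e)"
    using assms by (intro sum.mono_neutral_cong_left) auto
  moreover have "(\<Sum>e\<in>in_arcs D v. f e) = (\<Sum>e\<in>arcs D. of_bool (head D e = v) *\<^sub>R f e)"
    using assms by (intro sum.mono_neutral_cong_left) auto
  ultimately show ?thesis
    by (simp add: net_incidence_def scaleR_left_diff_distrib sum_subtractf)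
qed

lemma in_degree_eq_out_degree_iff:
  assumes "finite (arcs D)"
  shows "in_degree D v = out_degree D v \<longleftrightarrow> (\<Sum>e\<in>arcs D. net_incidence D v e) = 0"
proof -
  have "in_degree D v = out_degree D v \<longleftrightarrow>
      (\<Sum>e\<in>out_arcs D v. 1::real) = (\<Sum>e\<in>in_arcs D v. 1)"
    by (auto simp: in_degree_def out_degree_def)
  then show ?thesis
    using out_arcs_sum_eq_in_arcs_sum_iff[OF assms, where v = v and f = "\<lambda>_. 1::real"] by simp
qed

text \<open>Serves both directions of the theorem: \<open>K\<close> may come from
  \<open>\<phi>\<close>, or \<open>\<phi>\<close> from \<open>K\<close>. A vector sum vanishes iff
  all its coordinates do, and by \<open>coord\<close> the \<open>k\<close>-th coordinate is the
  signed arc count of \<open>K k\<close> at \<open>v\<close>.\<close>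

lemma flow_balanced_iff_coordinates_balanced:
  fixes \<phi> :: "'e \<Rightarrow> real ^ 'd" and K :: "'d \<Rightarrow> ('v, 'e) pre_digraph"
  assumes fin: "finite (arcs D)"
    and arcs: "\<And>k. arcs (K k) \<subseteq> arcs D"
    and coord: "\<And>k e. e \<in> arcs D \<Longrightarrow> net_incidence D v e * \<phi> e $ k =
      (if e \<in> arcs (K k) then net_incidence (K k) v e else 0)"
  shows "(\<Sum>e\<in>out_arcs D v. \<phi> e) = (\<Sum>e\<in>in_arcs D v. \<phi> e) \<longleftrightarrow>
    (\<forall>k. in_degree (K k) v = out_degree (K k) v)"
proof -
  have "(\<Sum>e\<in>arcs D. net_incidence D v e *\<^sub>R \<phi> e) $ k = (\<Sum>e\<in>arcs (K k). net_incidence (K k) v e)"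
    for k
  proof -
    have "(\<Sum>e\<in>arcs D. net_incidence D v e *\<^sub>R \<phi> e) $ k =
        (\<Sum>e\<in>arcs D. if e \<in> arcs (K k) then net_incidence (K k) v e else 0)"
      by (simp add: coord)
    also have "\<dots> = (\<Sum>e\<in>arcs (K k). net_incidence (K k) v e)"
      using fin arcs[of k] by (intro sum.mono_neutral_cong_right) auto
    finally show ?thesis .
  qed
  moreover have "finite (arcs (K k))" for k
    using arcs fin by (rule finite_subset)
  ultimately show ?thesis
    using fin by (simp add: out_arcs_sum_eq_in_arcs_sum_iff in_degree_eq_out_degree_iff vec_eq_iff)
qed

section \<open>Root vectors, degrees and directed cycles\<close>

text \<open>These are the roots of type A. In this form the two indices name the two cycles through
  an edge.\<close>

lemma H_vectors_iff:
  "x \<in> H_vectors \<longleftrightarrow> (\<exists>i j. i \<noteq> j \<and> x = axis i 1 - axis j 1)"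
proof
  assume "x \<in> H_vectors"
  then have "\<exists>!i. x $ i = 1" "\<exists>!j. x $ j = -1"
    and zero: "x $ k \<noteq> 1 \<and> x $ k \<noteq> -1 \<longrightarrow> x $ k = 0" for k
    by (auto simp: H_vectors_def)
  then obtain i j where ij: "\<And>k. x $ k = 1 \<longleftrightarrow> k = i" "\<And>k. x $ k = -1 \<longleftrightarrow> k = j"
    by metis
  then have "i \<noteq> j"
    by (metis one_neq_neg_one)
  moreover have "x $ k = (axis i 1 - axis j 1) $ k" for k
    using ij[of k] zero[of k] \<open>i \<noteq> j\<close> by (auto simp: axis_def)
  ultimately show "\<exists>i j. i \<noteq> j \<and> x = axis i 1 - axis j 1"
    unfolding vec_eq_iff by blast
next
  assume "\<exists>i j. i \<noteq> j \<and> x = axis i 1 - axis j 1"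
  then obtain i j where "i \<noteq> j" and x: "\<And>k. x $ k = (axis i 1 - axis j 1) $ k"
    by auto
  then have "x $ k = 1 \<longleftrightarrow> k = i" "x $ k = -1 \<longleftrightarrow> k = j"
    "x $ k \<noteq> 1 \<and> x $ k \<noteq> -1 \<longrightarrow> x $ k = 0" for k
    by (auto simp: axis_def)
  then show "x \<in> H_vectors"
    by (simp add: H_vectors_def)
qed

text \<open>Inclusion-exclusion: the arcs that both enter and leave \<open>v\<close> are exactly the
  loops at \<open>v\<close>, which \<open>degree_at\<close> counts a second time.\<close>

lemma degree_at_eq_in_degree_plus_out_degree:
  assumes "orientation_of D C" "finite (edges C)"
  shows "degree_at C v = in_degree D v + out_degree D v"
proof -
  have arcs: "arcs D = edges C" and ends: "\<And>e. e \<in> edges C \<Longrightarrow> ends C e = Upair (tail D e) (head D e)"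
    using assms(1) by (auto simp: orientation_of_def)
  have "{e \<in> edges C. v \<in> set_uprod (ends C e)} = in_arcs D v \<union> out_arcs D v"
    by (auto simp: arcs ends)
  moreover have "{e \<in> edges C. ends C e = Upair v v} = in_arcs D v \<inter> out_arcs D v"
    by (auto simp: arcs ends)
  moreover have "finite (in_arcs D v)" "finite (out_arcs D v)"
    using assms(2) by (simp_all add: arcs in_arcs_def out_arcs_def)
  ultimately show ?thesis
    using card_Un_Int[of "in_arcs D v" "out_arcs D v"]
    by (simp add: degree_at_def in_degree_def out_degree_def)
qed

text \<open>Each degree is twice the indegree, hence even.\<close>

lemma cycle_of_if_directed_cycle_on:
  assumes "subgraph_of C G" "finite (edges C)" "directed_cycle_on D C"
  shows "cycle_of C G"
  using assms degree_at_eq_in_degree_plus_out_degree[of D C]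
  by (auto simp: cycle_of_def directed_cycle_on_def)

text \<open>A cycle of the cover may miss vertices of the graph at which the flow equation is still
  required; no arc of the cycle meets such a vertex, so both degrees are 0.\<close>

lemma directed_cycle_balanced_everywhere:
  assumes "multigraph C" "directed_cycle_on D C"
  shows "in_degree D v = out_degree D v"
proof (cases "v \<in> vertices C")
  case True
  then show ?thesis
    using assms(2) by (simp add: directed_cycle_on_def)
next
  case False
  have "tail D e \<in> vertices C \<and> head D e \<in> vertices C" if "e \<in> arcs D" for e
  proof -
    have "e \<in> edges C" "ends C e = Upair (tail D e) (head D e)"
      using assms(2) that by (auto simp: directed_cycle_on_def orientation_of_def)
    then show ?thesis
      using assms(1) by (fastforce simp: multigraph_def)
  qed
  then have "in_arcs D v = {}" "out_arcs D v = {}"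
    using False by auto
  then show ?thesis
    by (simp add: in_degree_def out_degree_def)
qed

section \<open>From a flow to a cover\<close>

definition coordinate_cycle ::
  "('v, 'e) multigraph \<Rightarrow> ('e \<Rightarrow> real ^ 'd) \<Rightarrow> 'd \<Rightarrow> ('v, 'e) multigraph" where
  "coordinate_cycle G \<phi> k =
    \<lparr>vertices = vertices G, edges = {e \<in> edges G. \<phi> e $ k \<noteq> 0}, ends = ends G\<rparr>"

text \<open>For flow values in \<open>H_vectors\<close>, the else branch acts on an arc only when
  its entry is -1; edges with entry 0 are not arcs here.\<close>

definition coordinate_orientation ::
  "('v, 'e) pre_digraph \<Rightarrow> ('e \<Rightarrow> real ^ 'd) \<Rightarrow> 'd \<Rightarrow> ('v, 'e) pre_digraph" where
  "coordinate_orientation D \<phi> k =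
    \<lparr>verts = verts D, arcs = {e \<in> arcs D. \<phi> e $ k \<noteq> 0},
     tail = (\<lambda>e. if \<phi> e $ k = 1 then tail D e else head D e),
     head = (\<lambda>e. if \<phi> e $ k = 1 then head D e else tail D e)\<rparr>"

lemma coordinate_cycle_directed:
  fixes \<phi> :: "'e \<Rightarrow> real ^ 'd"
  assumes "finite (edges G)" "vector_flow H_vectors G D \<phi>"
  shows "directed_cycle_on (coordinate_orientation D \<phi> k) (coordinate_cycle G \<phi> k)"
proof -
  have D: "verts D = vertices G" "arcs D = edges G"
    "\<And>e. e \<in> edges G \<Longrightarrow> Upair (tail D e) (head D e) = ends G e"
    using assms(2) by (auto simp: vector_flow_def orientation_of_def)
  have H: "\<phi> e $ l = 0 \<or> \<phi> e $ l = 1 \<or> \<phi> e $ l = -1" if "e \<in> edges G" for e l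
    using assms(2) that by (auto simp: vector_flow_def H_vectors_def)
  have "in_degree (coordinate_orientation D \<phi> k) v = out_degree (coordinate_orientation D \<phi> k) v"
    if "v \<in> vertices G" for v
  proof -
    have "(\<Sum>e\<in>out_arcs D v. \<phi> e) = (\<Sum>e\<in>in_arcs D v. \<phi> e) \<longleftrightarrow>
      (\<forall>l. in_degree (coordinate_orientation D \<phi> l) v = out_degree (coordinate_orientation D \<phi> l) v)"
    proof (rule flow_balanced_iff_coordinates_balanced)
      show "net_incidence D v e * \<phi> e $ l = (if e \<in> arcs (coordinate_orientation D \<phi> l)
          then net_incidence (coordinate_orientation D \<phi> l) v e else 0)" if "e \<in> arcs D" for l e
        \<comment> \<open>Entry 1 keeps the sign of the incidence, entry -1 flips it just as the
          reversal does, and entry 0 removes the edge.\<close>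
        using H[of e l] that D(2) by (auto simp: coordinate_orientation_def net_incidence_def)
    qed (use assms(1) D(2) in \<open>auto simp: coordinate_orientation_def\<close>)
    then show ?thesis
      using assms(2) that by (simp add: vector_flow_def)
  qed
  moreover have "orientation_of (coordinate_orientation D \<phi> k) (coordinate_cycle G \<phi> k)"
    \<comment> \<open>Reversing an edge does not change its unordered pair of ends.\<close>
    using D by (auto simp: orientation_of_def coordinate_orientation_def coordinate_cycle_def
        simp flip: D(3))
  ultimately show ?thesis
    by (simp add: directed_cycle_on_def coordinate_cycle_def)
qed

text \<open>Coordinates are indexed by the type \<open>'d\<close> but cycles by the numbers below
  \<open>d\<close>; \<open>\<pi>\<close> translates between them.\<close>

lemma oriented_cycle_double_cover_if_flow:
  fixes \<phi> :: "'e \<Rightarrow> real ^ 'd"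
  assumes G: "finite_multigraph G" and flow: "vector_flow H_vectors G D \<phi>"
    and \<pi>: "bij_betw \<pi> {..<d} (UNIV :: 'd set)"
  shows "oriented_cycle_double_cover d G
    (\<lambda>n. coordinate_cycle G \<phi> (\<pi> n)) (\<lambda>n. coordinate_orientation D \<phi> (\<pi> n))"
  unfolding oriented_cycle_double_cover_def
proof (intro conjI allI impI ballI)
  fix n
  show directed: "directed_cycle_on (coordinate_orientation D \<phi> (\<pi> n)) (coordinate_cycle G \<phi> (\<pi> n))"
    using G flow by (intro coordinate_cycle_directed) (auto simp: finite_multigraph_def)
  have "subgraph_of (coordinate_cycle G \<phi> (\<pi> n)) G"
    using G by (auto simp: finite_multigraph_def subgraph_of_def multigraph_def coordinate_cycle_def)
  then show "cycle_of (coordinate_cycle G \<phi> (\<pi> n)) G"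
    using G directed
    by (intro cycle_of_if_directed_cycle_on) (auto simp: finite_multigraph_def coordinate_cycle_def)
next
  fix e assume e: "e \<in> edges G"
  have "\<phi> e \<in> H_vectors"
    using flow e by (simp add: vector_flow_def)
  then obtain a b where ab: "a \<noteq> b" "\<phi> e = axis a 1 - axis b 1"
    unfolding H_vectors_iff by blast
  have "a \<in> \<pi> ` {..<d}" "b \<in> \<pi> ` {..<d}"
    using \<pi> by (simp_all add: bij_betw_imp_surj_on)
  then obtain i j where ij: "i < d" "j < d" "\<pi> i = a" "\<pi> j = b"
    by auto
  have inj: "\<pi> k = \<pi> l \<longleftrightarrow> k = l" if "k < d" "l < d" for k l
    using \<pi> that by (auto simp: bij_betw_def inj_on_def)
  have "{k. k < d \<and> e \<in> edges (coordinate_cycle G \<phi> (\<pi> k))} = {k. k < d \<and> (\<pi> k = \<pi> i \<or> \<pi> k = \<pi> j)}"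
    using e ab ij by (auto simp: coordinate_cycle_def axis_def)
  also have "\<dots> = {i, j}"
    using ij inj by auto
  finally have "{k. k < d \<and> e \<in> edges (coordinate_cycle G \<phi> (\<pi> k))} = {i, j}" .
  moreover have "\<phi> e $ \<pi> i = 1" "\<phi> e $ \<pi> j = -1"
    using ab ij by (simp_all add: axis_def)
  \<comment> \<open>Cycle \<open>i\<close> follows \<open>D\<close> on \<open>e\<close>, and cycle
    \<open>j\<close> runs against it.\<close>
  then have "tail (coordinate_orientation D \<phi> (\<pi> i)) e = head (coordinate_orientation D \<phi> (\<pi> j)) e"
    "head (coordinate_orientation D \<phi> (\<pi> i)) e = tail (coordinate_orientation D \<phi> (\<pi> j)) e"
    by (simp_all add: coordinate_orientation_def)
  moreover have "i \<noteq> j"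
    using ab ij by blast
  ultimately show "\<exists>i<d. \<exists>j<d. i \<noteq> j \<and>
      {k. k < d \<and> e \<in> edges (coordinate_cycle G \<phi> (\<pi> k))} = {i, j} \<and>
      tail (coordinate_orientation D \<phi> (\<pi> i)) e = head (coordinate_orientation D \<phi> (\<pi> j)) e \<and>
      head (coordinate_orientation D \<phi> (\<pi> i)) e = tail (coordinate_orientation D \<phi> (\<pi> j)) e"
    using ij(1,2) by blast
qed

section \<open>From a cover to a flow\<close>

text \<open>Each edge takes its direction from one of its two cycles, whose coordinate gets 1, while
  the other gets -1. Exchanging the two cycles would reverse the edge and negate its vector, so
  either choice gives the same flow equations.\<close>

lemma flow_if_oriented_cycle_double_cover:
  fixes G :: "('v, 'e) multigraph" and \<pi> :: "nat \<Rightarrow> 'd::finite"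
  assumes G: "finite_multigraph G" and cover: "oriented_cycle_double_cover d G C K"
    and \<pi>: "bij_betw \<pi> {..<d} UNIV"
  shows "admits_vector_flow (H_vectors :: (real ^ 'd) set) G"
proof -
  \<comment> \<open>The two indices are bundled into a pair so that a single application of choice
    selects both for every edge.\<close>
  have "\<forall>e\<in>edges G. \<exists>p. fst p < d \<and> snd p < d \<and> fst p \<noteq> snd p \<and>
      {k. k < d \<and> e \<in> edges (C k)} = {fst p, snd p} \<and>
      tail (K (fst p)) e = head (K (snd p)) e \<and> head (K (fst p)) e = tail (K (snd p)) e"
    using cover unfolding oriented_cycle_double_cover_def split_paired_Ex fst_conv snd_conv by blast
  from bchoice[OF this] obtain p where p: "\<forall>e\<in>edges G. fst (p e) < d \<and> snd (p e) < d \<and>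
      fst (p e) \<noteq> snd (p e) \<and> {k. k < d \<and> e \<in> edges (C k)} = {fst (p e), snd (p e)} \<and>
      tail (K (fst (p e))) e = head (K (snd (p e))) e \<and>
      head (K (fst (p e))) e = tail (K (snd (p e))) e" ..
  define i j where "i e = fst (p e)" and "j e = snd (p e)" for e
  have ij: "i e < d \<and> j e < d \<and> i e \<noteq> j e"
    and supp: "{k. k < d \<and> e \<in> edges (C k)} = {i e, j e}"
    and opp: "tail (K (i e)) e = head (K (j e)) e \<and> head (K (i e)) e = tail (K (j e)) e"
    if "e \<in> edges G" for e
    using bspec[OF p that] unfolding i_def j_def by blast+
  have sub: "subgraph_of (C k) G" and dir: "directed_cycle_on (K k) (C k)" if "k < d" for k
    using cover that by (auto simp: oriented_cycle_double_cover_def cycle_of_def)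
  have C: "multigraph (C k)" "edges (C k) \<subseteq> edges G"
    "\<And>e. e \<in> edges (C k) \<Longrightarrow> ends (C k) e = ends G e" if "k < d" for k
    using sub[OF that] by (auto simp: subgraph_of_def)
  have K: "arcs (K k) = edges (C k)"
    "\<And>e. e \<in> edges (C k) \<Longrightarrow> Upair (tail (K k) e) (head (K k) e) = ends (C k) e" if "k < d" for k
    using dir[OF that] by (auto simp: directed_cycle_on_def orientation_of_def)
  define D where "D = \<lparr>verts = vertices G, arcs = edges G,
    tail = (\<lambda>e. tail (K (i e)) e), head = (\<lambda>e. head (K (i e)) e)\<rparr>"
  define \<phi> :: "'e \<Rightarrow> real ^ 'd" where "\<phi> e = axis (\<pi> (i e)) 1 - axis (\<pi> (j e)) 1" for e
  \<comment> \<open>Sends a coordinate back to the number of its cycle, so that the family of cycles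
    can be indexed by coordinates.\<close>
  define \<rho> where "\<rho> = the_inv_into {..<d} \<pi>"
  have \<rho>: "\<rho> a < d" "\<pi> (\<rho> a) = a" for a
    using f_the_inv_into_f_bij_betw[OF \<pi>, of a]
      bij_betw_apply[OF bij_betw_the_inv_into[OF \<pi>], of a]
    by (simp_all add: \<rho>_def)
  have \<pi>_eq: "\<pi> k = a \<longleftrightarrow> k = \<rho> a" if "k < d" for k a
    using \<pi> that \<rho> by (metis bij_betw_def inj_on_def lessThan_iff)
  have mem: "e \<in> edges (C k) \<longleftrightarrow> k = i e \<or> k = j e" if "e \<in> edges G" "k < d" for e k
    using supp[OF that(1)] that(2) by blast
  have net_i: "net_incidence D v e = net_incidence (K (i e)) v e" for v e
    by (simp add: net_incidence_def D_def)
  have net_j: "net_incidence (K (j e)) v e = - net_incidence (K (i e)) v e" if "e \<in> edges G" for v e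
    using opp[OF that] by (intro net_incidence_eq_minus_if_opposite) auto
  have "vector_flow H_vectors G D \<phi>"
    unfolding vector_flow_def
  proof (intro conjI ballI)
    show "orientation_of D G"
      \<comment> \<open>Edge \<open>e\<close> lies in \<open>C (i e)\<close>, so the orientation
        \<open>K (i e)\<close> gives it the right ends.\<close>
      using ij mem C K by (auto simp: orientation_of_def D_def)
  next
    fix e assume "e \<in> edges G"
    then have "\<pi> (i e) \<noteq> \<pi> (j e)"
      using ij[of e] \<pi>_eq by metis
    then show "\<phi> e \<in> H_vectors"
      unfolding H_vectors_iff \<phi>_def by blast
  next
    fix v
    have "(\<Sum>e\<in>out_arcs D v. \<phi> e) = (\<Sum>e\<in>in_arcs D v. \<phi> e) \<longleftrightarrow>
      (\<forall>a. in_degree (K (\<rho> a)) v = out_degree (K (\<rho> a)) v)"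
    proof (rule flow_balanced_iff_coordinates_balanced)
      show "finite (arcs D)"
        using G by (simp add: finite_multigraph_def D_def)
      show "arcs (K (\<rho> a)) \<subseteq> arcs D" for a
        using C(2) K(1) \<rho>(1) by (simp add: D_def)
      fix a e assume "e \<in> arcs D"
      then have e: "e \<in> edges G"
        by (simp add: D_def)
      have "\<phi> e $ a = of_bool (\<pi> (i e) = a) - of_bool (\<pi> (j e) = a)"
        by (auto simp: \<phi>_def axis_def)
      also have "\<dots> = of_bool (i e = \<rho> a) - of_bool (j e = \<rho> a)"
        using ij[OF e] by (simp only: \<pi>_eq)
      finally have coord: "\<phi> e $ a = of_bool (i e = \<rho> a) - of_bool (j e = \<rho> a)" .
      have arc: "e \<in> arcs (K (\<rho> a)) \<longleftrightarrow> \<rho> a = i e \<or> \<rho> a = j e"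
        using K(1)[OF \<rho>(1)] mem[OF e \<rho>(1)] by simp
      \<comment> \<open>In the first case direction and entry agree. In the second the entry -1
        cancels the sign from the opposite orientation. In the third both sides are 0.\<close>
      consider "\<rho> a = i e" | "\<rho> a = j e" | "\<rho> a \<noteq> i e" "\<rho> a \<noteq> j e"
        by blast
      then show "net_incidence D v e * \<phi> e $ a =
          (if e \<in> arcs (K (\<rho> a)) then net_incidence (K (\<rho> a)) v e else 0)"
        unfolding arc coord using ij[OF e] net_j[OF e, of v] by cases (simp_all add: net_i)
    qed
    moreover have "in_degree (K (\<rho> a)) v = out_degree (K (\<rho> a)) v" for a
      using \<rho>(1) C(1) dir by (intro directed_cycle_balanced_everywhere) auto
    ultimately show "(\<Sum>e\<in>out_arcs D v. \<phi> e) = (\<Sum>e\<in>in_arcs D v. \<phi> e)"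
      by blast
  qed
  then show ?thesis
    unfolding admits_vector_flow_def by blast
qed

theorem theorem4:
  fixes G :: "('v, 'e) multigraph"
  assumes "CARD('d::finite) \<ge> 3" and "finite_multigraph G"
  shows "admits_vector_flow (H_vectors :: (real ^ 'd) set) G \<longleftrightarrow>
    admits_oriented_cycle_double_cover CARD('d) G"
proof -
  obtain \<pi> where \<pi>: "bij_betw \<pi> {..<CARD('d)} (UNIV :: 'd set)"
    using ex_bij_betw_nat_finite[of "UNIV :: 'd set"] by (auto simp: atLeast0LessThan)
  show ?thesis
    using oriented_cycle_double_cover_if_flow[OF assms(2) _ \<pi>]
      flow_if_oriented_cycle_double_cover[OF assms(2) _ \<pi>]
    unfolding admits_vector_flow_def[of _ G] admits_oriented_cycle_double_cover_def by blast
qed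

end
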